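(* Let $\mathcal{H}_1,\mathcal{H}_2$ be Hilbert spaces, let $\mathcal{L}:\mathcal{H}_1\to\mathcal{H}_2$ be a nonzero bounded linear operator, and assume $$0<\gamma<\frac{2}{\|\mathcal{L}\|^2}.$$ Consider the series $$\sum_{j=0}^\infty (I-\gamma \mathcal{L}^*\mathcal{L})^j\,\gamma\,\mathcal{L}^*\mathcal{L} f,\qquad f\in\mathcal{H}_1,$$ with partial sums $S_N f=\sum_{j=0}^{N-1}(I-\gamma \mathcal{L}^*\mathcal{L})^j\gamma \mathcal{L}^*\mathcal{L} f$. For $f\in\mathcal{H}_1$ let $f_1$ denote the orthogonal projection of $f$ onto $(\operatorname{Ker}\mathcal{L})^\perp$. (a) For every $f\in\mathcal{H}_1$, the series converges (in $\mathcal{H}_1$) to $f_1$. (b) The series converges uniformly (i.e., the operators $S_N$ converge in the operator norm) if and only if the problem is stable. In that case, $S_N$ converges to the orthogonal projection $f\mapsto f_1$ exponentially fast in the operator norm; more precisely, with $\nu:=\min\left(\gamma\mu^2,\;2-\gamma\|\mathcal{L}\|^2\right)$, where $\mu>0$ is the stability constant of $\mathcal{L}$, $$\|S_N f-f_1\|\le (1-\nu)^N\|f_1\|\qquad\text{for all } f\in\mathcal{H}_1 \text{ and all } N\ge 1.$$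
   Context: The problem (of inverting a bounded operator $\mathcal{L}:\mathcal{H}_1\to\mathcal{H}_2$) is called stable if there exists $\mu>0$ such that $\mu\|f\|\le\|\mathcal{L}f\|$ for all $f\in(\operatorname{Ker}\mathcal{L})^\perp$ (equivalently, $\operatorname{Ran}\mathcal{L}$ is closed). When the problem is stable, the stability constant $\mu$ denotes the largest constant with this property. *)

theory Defs
  imports "HOL-Analysis.Analysis"
begin

text \<open>
  Hilbert spaces are taken over the reals or over the complex numbers. The axioms of the
  scalar class leave no further possibility: they force every \<open>x + sconj x\<close> to be real, so
  each scalar is a root of a real quadratic polynomial and the field is isomorphic to the reals
  or to the complex numbers.
\<close>

class real_or_complex = real_normed_field +
  fixes sconj :: "'a \<Rightarrow> 'a"
  assumes sconj_add: "sconj (x + y) = sconj x + sconj y"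
    and sconj_mult: "sconj (x * y) = sconj x * sconj y"
    and sconj_sconj: "sconj (sconj x) = x"
    and mult_sconj: "x * sconj x = (norm x)\<^sup>2 *\<^sub>R 1"

instantiation real :: real_or_complex
begin
definition sconj_real :: "real \<Rightarrow> real" where "sconj_real x = x"
instance by standard (auto simp: sconj_real_def power2_eq_square)
end

instantiation complex :: real_or_complex
begin
definition sconj_complex :: "complex \<Rightarrow> complex" where "sconj_complex = cnj"
instance by standard (auto simp: sconj_complex_def complex_norm_square[symmetric] scaleR_conv_of_real)
end

text \<open>
  Topology, norm and completeness come from the type class \<open>banach\<close>; the locale says that the
  norm is induced by an inner product, linear in its first argument, over the scalar field.
\<close>

locale hilbert_space = vector_space scale
  for scale :: "'k::real_or_complex \<Rightarrow> 'a::banach \<Rightarrow> 'a" +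
  fixes ip :: "'a \<Rightarrow> 'a \<Rightarrow> 'k"
  assumes scale_of_real: "scale (of_real r) x = r *\<^sub>R x"
    and ip_add_left: "ip (x + y) z = ip x z + ip y z"
    and ip_scale_left: "ip (scale c x) y = c * ip x y"
    and ip_commute: "ip y x = sconj (ip x y)"
    and ip_self: "ip x x = of_real ((norm x)\<^sup>2)"

lemma hilbert_space_real_inner:
  "hilbert_space scaleR (inner :: 'a::{real_inner, banach} \<Rightarrow> 'a \<Rightarrow> real)"
  by unfold_locales
    (auto simp: algebra_simps inner_commute sconj_real_def power2_norm_eq_inner)

lemma hilbert_space_complex: "hilbert_space (*) (\<lambda>x y :: complex. x * cnj y)"
  by unfold_locales
    (auto simp: algebra_simps sconj_complex_def scaleR_conv_of_real complex_norm_square[symmetric])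

definition bounded_operator ::
  "('k::real_or_complex \<Rightarrow> 'a::banach \<Rightarrow> 'a) \<Rightarrow> ('k \<Rightarrow> 'b::banach \<Rightarrow> 'b) \<Rightarrow> ('a \<Rightarrow> 'b) \<Rightarrow> bool"
  where "bounded_operator scale1 scale2 L \<longleftrightarrow>
    Vector_Spaces.linear scale1 scale2 L \<and> bounded_linear L"

text \<open>
  The library constant \<^const>\<open>adjoint\<close> only covers real inner products. By the Riesz
  representation theorem and definiteness of the inner product, the description below denotes a
  unique operator for every bounded \<open>L\<close> between Hilbert spaces.
\<close>

definition hadjoint ::
  "('a \<Rightarrow> 'a \<Rightarrow> 'k) \<Rightarrow> ('b \<Rightarrow> 'b \<Rightarrow> 'k) \<Rightarrow> ('a \<Rightarrow> 'b) \<Rightarrow> ('b \<Rightarrow> 'a)"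
  where "hadjoint ip1 ip2 L = (THE L'. \<forall>x y. ip2 (L x) y = ip1 x (L' y))"

definition orth_compl :: "('a \<Rightarrow> 'a \<Rightarrow> 'k::zero) \<Rightarrow> 'a set \<Rightarrow> 'a set"
  where "orth_compl ip M = {x. \<forall>y\<in>M. ip x y = 0}"

definition orth_proj :: "('a::ab_group_add \<Rightarrow> 'a \<Rightarrow> 'k::zero) \<Rightarrow> 'a set \<Rightarrow> 'a \<Rightarrow> 'a"
  where "orth_proj ip M f = (THE g. g \<in> M \<and> f - g \<in> orth_compl ip M)"

definition ker :: "('a \<Rightarrow> 'b::zero) \<Rightarrow> 'a set"
  where "ker L = {f. L f = 0}"

definition proj_ker_compl ::
  "('a::ab_group_add \<Rightarrow> 'a \<Rightarrow> 'k::zero) \<Rightarrow> ('a \<Rightarrow> 'b::zero) \<Rightarrow> 'a \<Rightarrow> 'a"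
  where "proj_ker_compl ip L f = orth_proj ip (orth_compl ip (ker L)) f"

definition stable_with ::
  "('a::real_normed_vector \<Rightarrow> 'a \<Rightarrow> 'k::zero) \<Rightarrow> ('a \<Rightarrow> 'b::real_normed_vector) \<Rightarrow> real \<Rightarrow> bool"
  where "stable_with ip L \<mu> \<longleftrightarrow>
    \<mu> > 0 \<and> (\<forall>f \<in> orth_compl ip (ker L). \<mu> * norm f \<le> norm (L f))"

definition stable_problem ::
  "('a::real_normed_vector \<Rightarrow> 'a \<Rightarrow> 'k::zero) \<Rightarrow> ('a \<Rightarrow> 'b::real_normed_vector) \<Rightarrow> bool"
  where "stable_problem ip L \<longleftrightarrow> (\<exists>\<mu>. stable_with ip L \<mu>)"

definition stability_constant ::
  "('a::real_normed_vector \<Rightarrow> 'a \<Rightarrow> 'k::zero) \<Rightarrow> ('a \<Rightarrow> 'b::real_normed_vector) \<Rightarrow> real"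
  where "stability_constant ip L = (GREATEST \<mu>. stable_with ip L \<mu>)"

definition series_term ::
  "('a::real_normed_vector \<Rightarrow> 'a \<Rightarrow> 'k) \<Rightarrow> ('b \<Rightarrow> 'b \<Rightarrow> 'k) \<Rightarrow> ('a \<Rightarrow> 'b) \<Rightarrow> real \<Rightarrow> nat \<Rightarrow> 'a \<Rightarrow> 'a"
  where "series_term ip1 ip2 L \<gamma> j f =
    ((\<lambda>g. g - \<gamma> *\<^sub>R hadjoint ip1 ip2 L (L g)) ^^ j) (\<gamma> *\<^sub>R hadjoint ip1 ip2 L (L f))"

definition partial_sum ::
  "('a::real_normed_vector \<Rightarrow> 'a \<Rightarrow> 'k) \<Rightarrow> ('b \<Rightarrow> 'b \<Rightarrow> 'k) \<Rightarrow> ('a \<Rightarrow> 'b) \<Rightarrow> real \<Rightarrow> nat \<Rightarrow> 'a \<Rightarrow> 'a"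
  where "partial_sum ip1 ip2 L \<gamma> N f = (\<Sum>j<N. series_term ip1 ip2 L \<gamma> j f)"

end

theory Submission imports Defs begin

text \<open>
  Put \<open>T = I - \<gamma> L\<^sup>*L\<close>. The partial sums telescope to \<open>S_N f = f - T^N f\<close>, and \<open>T\<close> fixes \<open>Ker L\<close>, so
  \<open>S_N f - f_1 = - T^N f_1\<close>. From \<open>\<parallel>T g\<parallel>\<^sup>2 + \<gamma> (2 - \<gamma> \<parallel>L\<parallel>\<^sup>2) \<parallel>L g\<parallel>\<^sup>2 \<le> \<parallel>g\<parallel>\<^sup>2\<close> it follows that \<open>T\<close> is a
  contraction and that \<open>L T^N g\<close> tends to \<open>0\<close>; hence \<open>T^N\<close> tends to \<open>0\<close> pointwise on the range of \<open>L\<^sup>*L\<close>,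
  whose closure is the orthogonal complement of the kernel. If the problem is stable, the numerical
  radius of the self-adjoint \<open>T\<close> on that complement is at most \<open>1 - \<nu>\<close>. Conversely, if
  \<open>\<parallel>S_N g - g\<parallel> \<le> \<parallel>g\<parallel> / 2\<close> on the complement for some \<open>N\<close>, then
  \<open>\<parallel>g\<parallel> \<le> 2 \<parallel>S_N g\<parallel> \<le> 2 N \<gamma> \<parallel>L\<parallel> \<parallel>L g\<parallel>\<close>.
\<close>

section \<open>Conjugation of real scalars, and the real inner product of a norm\<close>

lemma sconj_of_real: "sconj (of_real r) = (of_real r :: 'k::real_or_complex)"
proof (cases "r = 0")
  case True
  have "sconj (0 + 0 :: 'k) = sconj 0 + sconj 0"
    by (rule sconj_add)
  then show ?thesis using True by simp
next
  case False
  have "of_real r * sconj (of_real r) = (of_real r * of_real r :: 'k)"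
    by (simp add: mult_sconj scaleR_conv_of_real power2_eq_square flip: of_real_mult)
  then show ?thesis using False by simp
qed

text \<open>The real part of the inner product, expressed through the norm alone by polarization.\<close>

definition rip :: "'a::real_normed_vector \<Rightarrow> 'a \<Rightarrow> real"
  where "rip x y = ((norm (x + y))\<^sup>2 - (norm x)\<^sup>2 - (norm y)\<^sup>2) / 2"

lemma norm_add_sq: "(norm (x + y))\<^sup>2 = (norm x)\<^sup>2 + 2 * rip x y + (norm y)\<^sup>2"
  by (simp add: rip_def field_simps)

lemma rip_commute: "rip x y = rip y x"
  by (simp add: rip_def add.commute)

lemma rip_self: "rip x x = (norm x)\<^sup>2"
proof -
  have "norm (x + x) = 2 * norm x"
    by (simp flip: scaleR_2)
  then show ?thesis by (simp add: rip_def power2_eq_square)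
qed

text \<open>This is Cauchy-Schwarz; for the polarized form it amounts to squaring the triangle
  inequality and its reverse.\<close>

lemma abs_rip_le: "\<bar>rip x y\<bar> \<le> norm x * norm y"
proof -
  have "(norm (x + y))\<^sup>2 \<le> (norm x + norm y)\<^sup>2"
    by (intro power_mono norm_triangle_ineq) auto
  moreover have "\<bar>norm x - norm y\<bar>\<^sup>2 \<le> (norm (x + y))\<^sup>2"
    using norm_triangle_ineq3[of x "- y"] by (intro power_mono) auto
  ultimately show ?thesis
    by (simp add: rip_def power2_sum power2_diff abs_le_iff)
qed

lemma subspace_closure:
  fixes S :: "'a::real_normed_vector set"
  assumes "subspace S"
  shows "subspace (closure S)"
proof (rule subspaceI)
  show "0 \<in> closure S"
    using closure_subset subspace_0[OF assms] by blast
next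
  fix x y assume "x \<in> closure S" "y \<in> closure S"
  then obtain f g where "\<And>n. f n \<in> S" "f \<longlonglongrightarrow> x" "\<And>n. g n \<in> S" "g \<longlonglongrightarrow> y"
    by (auto simp: closure_sequential)
  then have "\<forall>n. f n + g n \<in> S" "(\<lambda>n. f n + g n) \<longlonglongrightarrow> x + y"
    using subspace_add[OF assms] by (auto intro: tendsto_add)
  then show "x + y \<in> closure S"
    unfolding closure_sequential by (intro exI conjI)
next
  fix c x assume "x \<in> closure S"
  then obtain f where "\<And>n. f n \<in> S" "f \<longlonglongrightarrow> x"
    by (auto simp: closure_sequential)
  then have "\<forall>n. c *\<^sub>R f n \<in> S" "(\<lambda>n. c *\<^sub>R f n) \<longlonglongrightarrow> c *\<^sub>R x"
    using subspace_scale[OF assms] by (auto intro: tendsto_scaleR)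
  then show "c *\<^sub>R x \<in> closure S"
    unfolding closure_sequential by (intro exI conjI)
qed

section \<open>Inner product calculus: from \<open>ip\<close> to its real part
  \<open>rip\<close>\<close>

context hilbert_space
begin

lemma ip_add_right: "ip x (y + z) = ip x y + ip x z"
  by (metis ip_add_left ip_commute sconj_add)

lemma ip_scale_right: "ip x (scale c y) = sconj c * ip x y"
  by (metis ip_scale_left ip_commute sconj_mult)

lemma ip_scaleR_left: "ip (r *\<^sub>R x) y = of_real r * ip x y"
  by (metis ip_scale_left scale_of_real)

lemma ip_scaleR_right: "ip x (r *\<^sub>R y) = of_real r * ip x y"
  by (metis ip_scale_right scale_of_real sconj_of_real)

lemma ip_diff_left: "ip (x - y) z = ip x z - ip y z"
  using ip_add_left[of "x - y" y z] by (simp add: algebra_simps)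

text \<open>A scalar plus its conjugate is twice its real part, over both fields. As
  \<open>of_real\<close> is injective, identities for \<open>ip\<close> descend to
  \<open>rip\<close>.\<close>

lemma of_real_rip: "of_real (2 * rip x y) = ip x y + ip y x"
proof -
  have "ip (x + y) (x + y) = ip x x + ip x y + (ip y x + ip y y)"
    by (simp add: ip_add_left ip_add_right)
  then show ?thesis
    by (simp add: ip_self rip_def)
qed

sublocale rip: bounded_bilinear "rip :: 'a \<Rightarrow> 'a \<Rightarrow> real"
proof
  have add: "rip (x + y) z = rip x z + rip y z" for x y z :: 'a
  proof -
    have "(of_real (2 * rip (x + y) z) :: 'k) = of_real (2 * (rip x z + rip y z))"
      by (simp only: of_real_rip distrib_left of_real_add) (simp add: ip_add_left ip_add_right)
    then show ?thesis unfolding of_real_eq_iff by simp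
  qed
  have scale: "rip (r *\<^sub>R x) y = r *\<^sub>R rip x y" for r and x y :: 'a
  proof -
    have "(of_real (2 * rip (r *\<^sub>R x) y) :: 'k) = of_real r * of_real (2 * rip x y)"
      by (simp only: of_real_rip) (simp add: ip_scaleR_left ip_scaleR_right distrib_left)
    then have "(of_real (2 * rip (r *\<^sub>R x) y) :: 'k) = of_real (r * (2 * rip x y))"
      by (simp only: of_real_mult)
    then show ?thesis unfolding of_real_eq_iff by simp
  qed
  fix x y z :: 'a and r :: real
  show "rip (x + y) z = rip x z + rip y z" "rip (r *\<^sub>R x) y = r *\<^sub>R rip x y"
    by (fact add scale)+
  show "rip x (y + z) = rip x y + rip x z" "rip x (r *\<^sub>R y) = r *\<^sub>R rip x y"
    by (metis add rip_commute) (metis scale rip_commute)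
  show "\<exists>K. \<forall>x y :: 'a. norm (rip x y) \<le> norm x * norm y * K"
    using abs_rip_le by (auto intro!: exI[of _ 1])
qed

lemma norm_diff_sq: "(norm (x - y))\<^sup>2 = (norm x)\<^sup>2 - 2 * rip x y + (norm y)\<^sup>2" for x y :: 'a
  using norm_add_sq[of x "- y"] by (simp add: rip.minus_right)

lemma parallelogram: "(norm (x + y))\<^sup>2 + (norm (x - y))\<^sup>2 = 2 * (norm x)\<^sup>2 + 2 * (norm y)\<^sup>2" for x y :: 'a
  by (simp add: norm_add_sq norm_diff_sq)

lemma rip_eqI: "x = y" if "\<And>z. rip z x = rip z y" for x y :: 'a
proof -
  have "rip (x - y) (x - y) = 0"
    using that[of "x - y"] by (simp add: rip.diff_right)
  then show ?thesis by (simp add: rip_self)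
qed

lemma ip_eq_0_iff_rip:
  "ip x y = 0 \<longleftrightarrow> (\<forall>c. rip x (scale c y) = 0)"
proof
  assume 0: "ip x y = 0"
  then have "ip y x = 0"
    by (metis ip_commute of_real_0 sconj_of_real)
  with 0 have "(of_real (2 * rip x (scale c y)) :: 'k) = 0" for c
    by (simp only: of_real_rip) (simp add: ip_scale_left ip_scale_right)
  then show "\<forall>c. rip x (scale c y) = 0" by simp
next
  assume 0: "\<forall>c. rip x (scale c y) = 0"
  \<comment> \<open>With this choice \<open>ip x (scale ?c y)\<close> is the nonnegative real
    \<open>(norm ?c)\<^sup>2\<close>, so passing to the real part loses nothing.\<close>
  let ?c = "ip x y"
  have "(of_real (2 * rip x (scale ?c y)) :: 'k) = of_real (2 * (norm ?c)\<^sup>2)"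
    unfolding of_real_rip
    by (simp add: ip_scale_left ip_scale_right ip_commute[of y x] mult_sconj mult.commute[of "sconj _"]
        scaleR_conv_of_real)
  then have "2 * rip x (scale ?c y) = 2 * (norm ?c)\<^sup>2"
    unfolding of_real_eq_iff .
  with 0 show "ip x y = 0" by simp
qed

section \<open>Orthogonal complements, projections and the Riesz theorem\<close>

lemma orth_compl_rip:
  assumes "\<And>c y. y \<in> M \<Longrightarrow> scale c y \<in> M"
  shows "orth_compl ip M = {x. \<forall>y\<in>M. rip x y = 0}"
proof -
  have "rip x y = 0" if "\<forall>y\<in>M. ip x y = 0" "y \<in> M" for x y
    using that ip_eq_0_iff_rip[of x y] by (metis scale_one)
  then show ?thesis
    unfolding orth_compl_def using assms by (auto simp: ip_eq_0_iff_rip)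
qed

text \<open>Two candidates for the projection differ by a vector that lies in the complement and is
  orthogonal to it, hence to itself.\<close>

lemma orth_proj_eqI:
  assumes "g \<in> orth_compl ip M" "f - g \<in> orth_compl ip (orth_compl ip M)"
  shows "orth_proj ip (orth_compl ip M) f = g"
  unfolding orth_proj_def
proof (rule the_equality)
  fix h assume h: "h \<in> orth_compl ip M \<and> f - h \<in> orth_compl ip (orth_compl ip M)"
  let ?d = "h - g"
  have d: "?d \<in> orth_compl ip M"
    using h assms by (auto simp: orth_compl_def ip_diff_left)
  have "?d = (f - g) - (f - h)" by simp
  then have "ip ?d ?d = ip (f - g) ?d - ip (f - h) ?d"
    by (metis ip_diff_left)
  also have "\<dots> = 0"
    using d h assms(2) unfolding orth_compl_def by simp
  finally show "h = g" by (simp add: ip_self)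
qed (use assms in auto)

text \<open>Covers both the Riesz representation theorem (\<open>M = UNIV\<close>) and the orthogonal projection
  onto \<open>M\<close> (\<open>\<phi> = rip f\<close>). The vector \<open>u\<close> minimizes \<open>(norm x)\<^sup>2 - 2 * \<phi> x\<close> over \<open>M\<close>.\<close>

lemma riesz_closed_subspace:
  fixes M :: "'a set" and \<phi> :: "'a \<Rightarrow> real"
  assumes M: "real_vector.subspace M" "closed M" and \<phi>: "bounded_linear \<phi>"
  obtains u where "u \<in> M" "\<And>m. m \<in> M \<Longrightarrow> rip u m = \<phi> m"
proof -
  interpret \<phi>: bounded_linear \<phi> by fact
  define Q where "Q x = (norm x)\<^sup>2 - 2 * \<phi> x" for x
  obtain K where K: "\<And>x. norm (\<phi> x) \<le> norm x * K"
    using \<phi>.bounded by blast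
  \<comment> \<open>Completing the square in \<open>norm x\<close> bounds \<open>Q\<close> from
    below.\<close>
  have "- K\<^sup>2 \<le> Q x" for x
  proof -
    have "0 \<le> (norm x - K)\<^sup>2" by simp
    then show ?thesis
      using K[of x] by (simp add: Q_def power2_diff)
  qed
  then have bdd: "bdd_below (Q ` M)" by (auto intro!: bdd_belowI)
  define d where "d = Inf (Q ` M)"
  have d_le: "d \<le> Q x" if "x \<in> M" for x
    unfolding d_def using that bdd by (auto intro: cInf_lower)
  have "\<exists>x\<in>M. Q x < d + 1 / real (Suc n)" for n
  proof -
    have "Inf (Q ` M) < d + 1 / real (Suc n)" by (simp add: d_def)
    then show ?thesis
      using cInf_lessD[of "Q ` M"] real_vector.subspace_0[OF M(1)] by blast
  qed
  then obtain s where s: "\<And>n. s n \<in> M" "\<And>n. Q (s n) < d + 1 / real (Suc n)"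
    by metis
  \<comment> \<open>The midpoint of \<open>x\<close> and \<open>y\<close> stays in \<open>M\<close>,
    so \<open>Q\<close> is at least \<open>d\<close> there; with the parallelogram law this makes a
    minimizing sequence Cauchy.\<close>
  have close: "(norm (x - y))\<^sup>2 \<le> 2 * (Q x - d) + 2 * (Q y - d)" if "x \<in> M" "y \<in> M" for x y
  proof -
    have "d \<le> Q ((1/2) *\<^sub>R (x + y))"
      using that M(1) by (intro d_le real_vector.subspace_scale real_vector.subspace_add)
    also have "\<dots> = (norm (x + y))\<^sup>2 / 4 - \<phi> x - \<phi> y"
      by (simp add: Q_def \<phi>.scaleR \<phi>.add power_divide add_divide_distrib)
    finally show ?thesis
      using parallelogram[of x y] by (simp add: Q_def)
  qed
  have "Cauchy s"
  proof (rule metric_CauchyI)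
    fix e :: real assume "0 < e"
    then have "0 < e\<^sup>2 / 4" by simp
    then obtain N where N: "1 / real (Suc N) < e\<^sup>2 / 4"
      by (rule reals_Archimedean[THEN exE]) (simp only: inverse_eq_divide)
    have le: "Q (s n) - d < e\<^sup>2 / 4" if "n \<ge> N" for n
    proof -
      have "1 / real (Suc n) \<le> 1 / real (Suc N)"
        using that by (intro divide_left_mono) auto
      then show ?thesis using s(2)[of n] N by simp
    qed
    have "dist (s m) (s n) < e" if "m \<ge> N" "n \<ge> N" for m n
    proof (rule power2_less_imp_less)
      show "(dist (s m) (s n))\<^sup>2 < e\<^sup>2"
        using close[OF s(1) s(1), of m n] le[OF that(1)] le[OF that(2)]
        by (simp add: dist_norm)
    qed (use \<open>0 < e\<close> in auto)
    then show "\<exists>N. \<forall>m\<ge>N. \<forall>n\<ge>N. dist (s m) (s n) < e" by blast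
  qed
  then obtain u where u: "s \<longlonglongrightarrow> u"
    using Cauchy_convergent convergent_def by blast
  have uM: "u \<in> M"
    using M(2) s(1) u closed_sequentially by blast
  have "(\<lambda>n. Q (s n)) \<longlonglongrightarrow> Q u"
    unfolding Q_def by (intro tendsto_intros u \<phi>.tendsto)
  moreover have "(\<lambda>n. d + 1 / real (Suc n)) \<longlonglongrightarrow> d + 0"
    by (intro tendsto_intros LIMSEQ_Suc[OF lim_1_over_n])
  ultimately have "Q u \<le> d + 0"
    by (rule LIMSEQ_le) (use s(2) less_imp_le in blast)
  then have min: "Q u \<le> Q x" if "x \<in> M" for x
    using d_le[OF that] by simp
  have "rip u m = \<phi> m" if m: "m \<in> M" for m
  proof -
    define a where "a = rip u m - \<phi> m"
    \<comment> \<open>The best \<open>t\<close> would be \<open>- a / (norm m)\<^sup>2\<close>; the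
      added 1 permits \<open>m = 0\<close> and still makes \<open>Q\<close> drop strictly unless
      \<open>a = 0\<close>.\<close>
    define b where "b = (norm m)\<^sup>2 + 1"
    have b: "b > 0" by (simp add: b_def add_nonneg_pos)
    define t where "t = - (a / b)"
    have "Q u \<le> Q (u + t *\<^sub>R m)"
      using m uM M(1) by (intro min real_vector.subspace_add real_vector.subspace_scale)
    also have "\<dots> = Q u + 2 * t * a + t\<^sup>2 * (norm m)\<^sup>2"
      by (simp add: Q_def norm_add_sq \<phi>.add \<phi>.scaleR rip.scaleR_right
          a_def power_mult_distrib algebra_simps)
    also have "(norm m)\<^sup>2 = b - 1" by (simp add: b_def)
    finally have "0 \<le> 2 * t * a + t\<^sup>2 * (b - 1)" by simp
    also have "\<dots> = - (a\<^sup>2 / b) - (a / b)\<^sup>2"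
      using b by (simp add: t_def field_simps power2_eq_square)
    finally have "(a / b)\<^sup>2 \<le> 0"
      using b by (smt (verit) divide_nonneg_pos zero_le_power2)
    then show ?thesis using b by (simp add: a_def)
  qed
  then show ?thesis using uM that by blast
qed

end

section \<open>The adjoint of a bounded operator\<close>

locale hilbert_operator =
  H1: hilbert_space scale1 ip1 + H2: hilbert_space scale2 ip2
  for scale1 :: "'k::real_or_complex \<Rightarrow> 'a::banach \<Rightarrow> 'a" and ip1
    and scale2 :: "'k \<Rightarrow> 'b::banach \<Rightarrow> 'b" and ip2 +
  fixes L :: "'a \<Rightarrow> 'b"
  assumes bounded_operator_L: "bounded_operator scale1 scale2 L"
begin

sublocale L: bounded_linear L
  using bounded_operator_L by (simp add: bounded_operator_def)

lemma L_scale: "L (scale1 c x) = scale2 c (L x)"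
  using bounded_operator_L
  by (simp add: bounded_operator_def Vector_Spaces.linear_def module_hom_def module_hom_axioms_def)

abbreviation "adj \<equiv> hadjoint ip1 ip2 L"

text \<open>Riesz yields an adjoint with respect to \<open>rip\<close>; homogeneity of
  \<open>L\<close> over the scalar field upgrades it to \<open>ip\<close>.\<close>

lemma adjoint_exists: "\<exists>L'. \<forall>x y. ip2 (L x) y = ip1 x (L' y)"
proof -
  have "\<exists>u. \<forall>x. rip u x = rip (L x) y" for y
  proof -
    have "bounded_linear (\<lambda>x. rip (L x) y)"
      by (rule bounded_linear_compose[OF H2.rip.bounded_linear_left L.bounded_linear_axioms])
    then obtain u where "\<And>m. m \<in> UNIV \<Longrightarrow> rip u m = rip (L m) y"
      by (rule H1.riesz_closed_subspace[OF real_vector.subspace_UNIV closed_UNIV]) blast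
    then show ?thesis by blast
  qed
  then obtain L' where L': "\<And>x y. rip (L' y) x = rip (L x) y"
    by metis
  have "ip2 (L x) y = ip1 x (L' y)" for x y
  proof -
    define D where "D = ip2 (L x) y - ip1 x (L' y)"
    \<comment> \<open>The factor \<open>sconj D\<close> rotates the defect \<open>D\<close> to the
      nonnegative real \<open>(norm D)\<^sup>2\<close>, which the identity for \<open>rip\<close>
      forces to vanish.\<close>
    define z where "z = scale1 (sconj D) x"
    have "ip2 (L z) y - ip1 z (L' y) = sconj D * D"
      by (simp add: D_def z_def L_scale H1.ip_scale_left H2.ip_scale_left right_diff_distrib)
    also have "\<dots> = of_real ((norm D)\<^sup>2)"
      by (simp add: mult_sconj mult.commute[of "sconj _"] scaleR_conv_of_real)
    finally have D: "ip2 (L z) y = of_real ((norm D)\<^sup>2) + ip1 z (L' y)"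
      by (simp add: algebra_simps)
    have "(of_real (2 * rip (L z) y) :: 'k) = of_real (2 * (norm D)\<^sup>2) + of_real (2 * rip z (L' y))"
      unfolding H1.of_real_rip H2.of_real_rip H2.ip_commute[of y] H1.ip_commute[of "L' y"] D
      by (simp add: sconj_add sconj_of_real flip: of_real_power)
    then have "(of_real (2 * rip (L z) y) :: 'k) = of_real (2 * (norm D)\<^sup>2 + 2 * rip z (L' y))"
      by (simp only: of_real_add)
    then have "2 * rip (L z) y = 2 * (norm D)\<^sup>2 + 2 * rip z (L' y)"
      unfolding of_real_eq_iff .
    with L'[of y z] show ?thesis
      by (simp add: rip_commute D_def)
  qed
  then show ?thesis by blast
qed

text \<open>Existence and uniqueness justify the definite description behind \<open>adj\<close>;
  uniqueness comes from pairing with the difference of two candidates.\<close>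

lemma ip_adj: "ip2 (L x) y = ip1 x (adj y)"
proof -
  obtain L' where L': "\<forall>x y. ip2 (L x) y = ip1 x (L' y)"
    using adjoint_exists by blast
  have "L'' = L'" if "\<forall>x y. ip2 (L x) y = ip1 x (L'' y)" for L''
  proof
    fix y
    let ?d = "L'' y - L' y"
    have "ip1 ?d (L'' y) = ip1 ?d (L' y)"
      using that L' by metis
    moreover have "ip1 ?d (L'' y) = ip1 ?d ?d + ip1 ?d (L' y)"
      by (simp flip: H1.ip_add_right)
    ultimately show "L'' y = L' y" by (simp add: H1.ip_self)
  qed
  then have "\<forall>x y. ip2 (L x) y = ip1 x (adj y)"
    unfolding hadjoint_def by (rule theI[where P="\<lambda>L'. \<forall>x y. ip2 (L x) y = ip1 x (L' y)", OF L'])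
  then show ?thesis by blast
qed

lemma rip_adj: "rip (L x) y = rip x (adj y)"
proof -
  have "(of_real (2 * rip (L x) y) :: 'k) = of_real (2 * rip x (adj y))"
    unfolding H1.of_real_rip H2.of_real_rip H2.ip_commute[of y] H1.ip_commute[of "adj y"]
    by (simp add: ip_adj)
  then show ?thesis unfolding of_real_eq_iff by simp
qed

lemma norm_L_le: "norm (L x) \<le> onorm L * norm x"
  by (rule onorm[OF L.bounded_linear_axioms])

lemma norm_adj_le: "norm (adj y) \<le> onorm L * norm y"
proof -
  have "(norm (adj y))\<^sup>2 = rip (L (adj y)) y"
    by (simp add: rip_adj rip_self)
  also have "\<dots> \<le> norm (L (adj y)) * norm y"
    using abs_rip_le abs_le_D1 by blast
  also have "\<dots> \<le> onorm L * norm (adj y) * norm y"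
    by (intro mult_right_mono norm_L_le) auto
  finally have "norm (adj y) * norm (adj y) \<le> norm (adj y) * (onorm L * norm y)"
    by (simp add: power2_eq_square algebra_simps)
  then show ?thesis
    using onorm_pos_le[OF L.bounded_linear_axioms]
    by (cases "norm (adj y) = 0") (auto simp: mult_le_cancel_left)
qed

sublocale adj: bounded_linear adj
proof (rule bounded_linear_intro)
  show "adj (x + y) = adj x + adj y" for x y
    by (rule H1.rip_eqI) (simp add: H1.rip.add_right H2.rip.add_right flip: rip_adj)
  show "adj (r *\<^sub>R x) = r *\<^sub>R adj x" for r x
    by (rule H1.rip_eqI) (simp add: H1.rip.scaleR_right H2.rip.scaleR_right flip: rip_adj)
  show "norm (adj y) \<le> norm y * onorm L" for y
    using norm_adj_le[of y] by (simp add: mult.commute)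
qed

section \<open>The complement of the kernel and the projection \<open>P\<close> onto it\<close>

abbreviation "N_compl \<equiv> orth_compl ip1 (ker L)"
abbreviation "P \<equiv> proj_ker_compl ip1 L"

lemma N_compl_iff: "x \<in> N_compl \<longleftrightarrow> (\<forall>y. L y = 0 \<longrightarrow> rip x y = 0)"
  by (subst H1.orth_compl_rip) (auto simp: ker_def L_scale)

text \<open>\<open>f - g\<close> lies in the kernel, hence is orthogonal to all of
  \<open>N_compl\<close>. Facts about the projection thereby reduce to membership and an equation
  under \<open>L\<close>.\<close>

lemma P_eqI:
  assumes "g \<in> N_compl" "L f = L g"
  shows "P f = g"
  unfolding proj_ker_compl_def
proof (rule H1.orth_proj_eqI[OF assms(1)])
  have "ip1 (f - g) y = 0" if "y \<in> N_compl" for y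
  proof -
    have "ip1 y (f - g) = 0"
      using that assms(2) by (simp add: orth_compl_def ker_def L.diff)
    then show ?thesis
      by (metis H1.ip_commute of_real_0 sconj_of_real)
  qed
  then show "f - g \<in> orth_compl ip1 N_compl"
    by (simp add: orth_compl_def[of _ "orth_compl _ _"])
qed

text \<open>If \<open>L y = 0\<close>, then \<open>rip (adj (L x)) y = rip (L x) (L y) = 0\<close>,
  and the complement is closed. The range of \<open>L\<^sup>*L\<close> is taken because the
  iteration commutes with \<open>L\<^sup>*L\<close>.\<close>

lemma closure_range_subset: "closure (range (\<lambda>x. adj (L x))) \<subseteq> N_compl"
proof (rule closure_minimal)
  show "range (\<lambda>x. adj (L x)) \<subseteq> N_compl"
    by (auto simp: N_compl_iff rip_commute[of "adj _"] H2.rip.zero_left simp flip: rip_adj)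
  have "N_compl = (\<Inter>y\<in>{y. L y = 0}. {x. rip x y = 0})"
    by (auto simp: N_compl_iff)
  then show "closed N_compl"
    by (auto intro!: closed_INT closed_Collect_eq H1.rip.continuous_on continuous_intros)
qed

text \<open>The orthogonal complement of the range of \<open>L\<^sup>*L\<close> is the kernel of \<open>L\<close>, since
  \<open>L\<^sup>*L x = 0\<close> forces \<open>norm (L x) = 0\<close>.\<close>

lemma P_in_closure_and_L_P:
  "P f \<in> closure (range (\<lambda>x. adj (L x)))" "L (P f) = L f"
proof -
  let ?M = "closure (range (\<lambda>x. adj (L x)))"
  have lin: "linear (\<lambda>x. adj (L x))"
    by (intro bounded_linear.linear bounded_linear_compose[OF adj.bounded_linear_axioms L.bounded_linear_axioms])
  have "real_vector.subspace (range (\<lambda>x. adj (L x)))"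
    using real_vector.linear_subspace_image[OF lin real_vector.subspace_UNIV] .
  then have "real_vector.subspace ?M"
    by (rule subspace_closure)
  then obtain p where p: "p \<in> ?M" "\<And>m. m \<in> ?M \<Longrightarrow> rip p m = rip f m"
    using H1.riesz_closed_subspace[OF _ closed_closure H1.rip.bounded_linear_right] by metis
  \<comment> \<open>The residual is tested against its own image under \<open>L\<^sup>*L\<close>,
    which produces the squared norm of \<open>L (f - p)\<close>.\<close>
  have "rip (f - p) (adj (L (f - p))) = 0"
    using p(2)[OF subsetD[OF closure_subset rangeI], of "f - p"] by (simp add: H1.rip.diff_left)
  then have "L f = L p"
    by (simp add: rip_self L.diff flip: rip_adj)
  moreover from this have "P f = p"
    using p(1) closure_range_subset by (intro P_eqI) auto
  ultimately show "P f \<in> ?M" "L (P f) = L f"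
    using p(1) by auto
qed

lemma P_in: "P f \<in> N_compl"
  using P_in_closure_and_L_P(1) closure_range_subset by blast

lemma P_eq_self: "f \<in> N_compl \<Longrightarrow> P f = f"
  by (rule P_eqI) auto

lemma norm_P_le: "norm (P f) \<le> norm f"
proof -
  have "rip (P f) (f - P f) = 0"
    using P_in[of f] by (auto simp: N_compl_iff L.diff P_in_closure_and_L_P)
  then have "(norm f)\<^sup>2 = (norm (P f))\<^sup>2 + (norm (f - P f))\<^sup>2"
    using norm_add_sq[of "P f" "f - P f"] by simp
  then show ?thesis
    by (smt (verit) norm_ge_zero power2_le_imp_le zero_le_power2)
qed

text \<open>Needed to offer \<open>P\<close> as the uniform limit; linearity follows from the
  uniqueness in \<open>P_eqI\<close>.\<close>

lemma bounded_operator_P: "bounded_operator scale1 scale1 P"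
proof -
  have add: "P (x + y) = P x + P y" for x y
    using P_in[of x] P_in[of y]
    by (intro P_eqI) (auto simp: N_compl_iff H1.rip.add_left L.add P_in_closure_and_L_P)
  have scale: "P (scale1 c x) = scale1 c (P x)" for c x
    using P_in[of x]
    by (intro P_eqI) (auto simp: orth_compl_def H1.ip_scale_left L_scale P_in_closure_and_L_P)
  have "bounded_linear P"
  proof (rule bounded_linear_intro)
    show "P (r *\<^sub>R x) = r *\<^sub>R P x" for r x
      using scale[of "of_real r" x] by (simp add: H1.scale_of_real)
    show "norm (P x) \<le> norm x * 1" for x
      using norm_P_le by simp
  qed (rule add)
  moreover have "Vector_Spaces.linear scale1 scale1 P"
    by unfold_locales (fact add scale)+
  ultimately show ?thesis by (simp add: bounded_operator_def)
qed

text \<open>\<open>GREATEST\<close> is meaningful only if a maximum exists. The admissible constants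
  are bounded by \<open>onorm L\<close>, as \<open>N_compl\<close> contains a nonzero vector, and
  the inequality passes to their supremum.\<close>

lemma stability_constant:
  assumes "L \<noteq> (\<lambda>_. 0)" "stable_problem ip1 L"
  shows "stable_with ip1 L (stability_constant ip1 L)"
proof -
  let ?S = "{m. stable_with ip1 L m}"
  obtain f where f: "L f \<noteq> 0" using assms(1) by auto
  define g where "g = P f"
  have g: "g \<in> N_compl" "norm g > 0"
    using P_in f P_in_closure_and_L_P(2)[of f] by (auto simp: g_def L.zero)
  have "m \<le> onorm L" if "m \<in> ?S" for m
  proof -
    have "m * norm g \<le> onorm L * norm g"
      using that g(1) norm_L_le[of g] by (force simp: stable_with_def)
    then show ?thesis using g(2) by simp
  qed
  then have bdd: "bdd_above ?S" by (rule bdd_aboveI)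
  obtain m0 where m0: "m0 \<in> ?S"
    using assms(2) by (auto simp: stable_problem_def)
  have le: "m \<le> Sup ?S" if "stable_with ip1 L m" for m
    using that bdd by (auto intro: cSup_upper)
  have "Sup ?S * norm h \<le> norm (L h)" if "h \<in> N_compl" for h
  proof (cases "norm h = 0")
    case False
    have "Sup ?S \<le> norm (L h) / norm h"
    proof (rule cSup_least)
      show "m \<le> norm (L h) / norm h" if "m \<in> ?S" for m
        using that \<open>h \<in> N_compl\<close> False by (auto simp: stable_with_def field_simps)
    qed (use m0 in blast)
    then show ?thesis using False by (simp add: field_simps)
  qed simp
  moreover have "Sup ?S > 0"
    using m0 le[of m0] by (auto simp: stable_with_def)
  ultimately have "stable_with ip1 L (Sup ?S)"
    by (simp add: stable_with_def)
  then show ?thesis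
    unfolding stability_constant_def using le by (metis GreatestI2_order)
qed

end

section \<open>The iteration \<open>step\<close> and its pointwise limit\<close>

locale landweber = hilbert_operator +
  fixes \<gamma> :: real
  assumes gamma_pos: "0 < \<gamma>" and gamma_less: "\<gamma> < 2 / (onorm L)\<^sup>2"
begin

abbreviation "step \<equiv> \<lambda>g. g - \<gamma> *\<^sub>R adj (L g)"

text \<open>As division by zero gives 0, a vanishing \<open>onorm L\<close> would turn
  \<open>gamma_less\<close> into \<open>\<gamma> < 0\<close>.\<close>

lemma onorm_L_pos: "0 < onorm L"
  using gamma_pos gamma_less onorm_pos_le[OF L.bounded_linear_axioms]
  by (cases "onorm L = 0") auto

lemma gap_pos: "0 < 2 - \<gamma> * (onorm L)\<^sup>2"
  using gamma_less onorm_L_pos by (simp add: field_simps)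

lemma bounded_linear_step: "bounded_linear step"
  by (intro bounded_linear_sub bounded_linear_ident bounded_linear_const_scaleR
      bounded_linear_compose[OF adj.bounded_linear_axioms L.bounded_linear_axioms])

lemma bounded_linear_step_pow: "bounded_linear (step ^^ n)"
proof (induction n)
  case 0
  then show ?case by (simp add: id_def)
next
  case (Suc n)
  then show ?case
    using bounded_linear_compose[OF bounded_linear_step Suc] by (simp add: o_def)
qed

text \<open>The cross term \<open>rip g (adj (L g))\<close> equals
  \<open>(norm (L g))\<^sup>2\<close>, and \<open>norm_adj_le\<close> bounds the quadratic term. The
  inequality measures the energy lost in one step.\<close>

lemma norm_step_sq:
  "(norm (step g))\<^sup>2 + \<gamma> * (2 - \<gamma> * (onorm L)\<^sup>2) * (norm (L g))\<^sup>2 \<le> (norm g)\<^sup>2"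
proof -
  have "(norm (step g))\<^sup>2 = (norm g)\<^sup>2 - 2 * \<gamma> * (norm (L g))\<^sup>2 + \<gamma>\<^sup>2 * (norm (adj (L g)))\<^sup>2"
    by (simp add: H1.norm_diff_sq H1.rip.scaleR_right power_mult_distrib rip_self flip: rip_adj)
  moreover have "(norm (adj (L g)))\<^sup>2 \<le> (onorm L)\<^sup>2 * (norm (L g))\<^sup>2"
    using power_mono[OF norm_adj_le[of "L g"], of 2] by (simp add: power_mult_distrib)
  then have "\<gamma>\<^sup>2 * (norm (adj (L g)))\<^sup>2 \<le> \<gamma>\<^sup>2 * ((onorm L)\<^sup>2 * (norm (L g))\<^sup>2)"
    by (intro mult_left_mono) auto
  ultimately show ?thesis
    by (simp add: algebra_simps power2_eq_square)
qed

lemma norm_step_le: "norm (step g) \<le> norm g"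
proof -
  have "0 \<le> \<gamma> * (2 - \<gamma> * (onorm L)\<^sup>2) * (norm (L g))\<^sup>2"
    using gamma_pos gap_pos by simp
  with norm_step_sq[of g] have "(norm (step g))\<^sup>2 \<le> (norm g)\<^sup>2" by linarith
  then show ?thesis by (rule power2_le_imp_le) simp
qed

lemma norm_step_pow_le: "norm ((step ^^ n) g) \<le> norm g"
  by (induction n) (auto intro: order_trans[OF norm_step_le])

lemma partial_sum_eq: "partial_sum ip1 ip2 L \<gamma> n f = f - (step ^^ n) f"
proof (induction n)
  case (Suc n)
  \<comment> \<open>The new summand becomes a difference of consecutive iterates, so the sum
    telescopes.\<close>
  have "(step ^^ n) (\<gamma> *\<^sub>R adj (L f)) = (step ^^ n) (f - step f)" by simp
  also have "\<dots> = (step ^^ n) f - (step ^^ n) (step f)"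
    using bounded_linear.linear[OF bounded_linear_step_pow] by (rule linear_diff)
  also have "(step ^^ n) (step f) = (step ^^ Suc n) f"
    by (simp only: funpow_Suc_right o_apply)
  finally show ?case
    using Suc by (simp add: partial_sum_def series_term_def)
qed (simp add: partial_sum_def)

lemma step_pow_ker: "L h = 0 \<Longrightarrow> (step ^^ n) h = h"
  by (induction n) (auto simp: adj.zero)

lemma partial_sum_diff_P: "partial_sum ip1 ip2 L \<gamma> n f - P f = - (step ^^ n) (P f)"
proof -
  have "(step ^^ n) f = (step ^^ n) (f - P f) + (step ^^ n) (P f)"
    using linear_add[OF bounded_linear.linear[OF bounded_linear_step_pow], of n "f - P f" "P f"]
    by simp
  also have "(step ^^ n) (f - P f) = f - P f"
    by (rule step_pow_ker) (simp add: L.diff P_in_closure_and_L_P)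
  finally show ?thesis by (simp add: partial_sum_eq)
qed

text \<open>The energy losses of all steps add up to at most \<open>(norm g)\<^sup>2\<close>, so
  they form a convergent series and tend to 0.\<close>

lemma L_step_pow_tendsto_0: "(\<lambda>n. L ((step ^^ n) g)) \<longlonglongrightarrow> 0"
proof -
  define c where "c = \<gamma> * (2 - \<gamma> * (onorm L)\<^sup>2)"
  have c: "c > 0" using gamma_pos gap_pos by (simp add: c_def)
  have "(norm ((step ^^ n) g))\<^sup>2 + (\<Sum>j<n. c * (norm (L ((step ^^ j) g)))\<^sup>2) \<le> (norm g)\<^sup>2" for n
    by (induction n) (use norm_step_sq[folded c_def] in \<open>auto intro: order_trans[rotated]\<close>)
  then have "(\<Sum>j<n. c * (norm (L ((step ^^ j) g)))\<^sup>2) \<le> (norm g)\<^sup>2" for n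
    by (smt (verit) zero_le_power2)
  then have "summable (\<lambda>j. c * (norm (L ((step ^^ j) g)))\<^sup>2)"
    using c by (intro summableI_nonneg_bounded[where x="(norm g)\<^sup>2"]) auto
  then have "(\<lambda>j. (norm (L ((step ^^ j) g)))\<^sup>2) \<longlonglongrightarrow> 0"
    using c by (auto dest: summable_LIMSEQ_zero simp: summable_cmult_iff)
  then have "(\<lambda>j. sqrt ((norm (L ((step ^^ j) g)))\<^sup>2)) \<longlonglongrightarrow> sqrt 0"
    by (rule tendsto_real_sqrt)
  then show ?thesis by (simp add: tendsto_norm_zero_iff)
qed

text \<open>\<open>step\<close> is a polynomial in \<open>L\<^sup>*L\<close>. Commuting carries the
  decay of \<open>L ((step ^^ n) g)\<close> over to the iterates of
  \<open>adj (L g)\<close>.\<close>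

lemma step_pow_comm: "(step ^^ n) (adj (L g)) = adj (L ((step ^^ n) g))"
  by (induction n) (auto simp: L.diff adj.diff L.scaleR adj.scaleR)

text \<open>Convergence on the range of \<open>L\<^sup>*L\<close> passes to its closure because the iterates are
  uniformly bounded.\<close>

lemma step_pow_tendsto_0:
  assumes "h \<in> closure (range (\<lambda>x. adj (L x)))"
  shows "(\<lambda>n. (step ^^ n) h) \<longlonglongrightarrow> 0"
proof (rule LIMSEQ_I)
  fix e :: real assume "0 < e"
  then obtain g where g: "norm (adj (L g) - h) < e / 2"
    using assms[unfolded closure_approachable, rule_format, of "e / 2"] by (auto simp: dist_norm)
  have "(\<lambda>n. (step ^^ n) (adj (L g))) \<longlonglongrightarrow> 0"
    using adj.tendsto[OF L_step_pow_tendsto_0] by (simp add: step_pow_comm adj.zero)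
  then obtain N where N: "\<And>n. n \<ge> N \<Longrightarrow> norm ((step ^^ n) (adj (L g))) < e / 2"
    using LIMSEQ_D[of _ 0 "e / 2"] \<open>0 < e\<close> by auto
  have "norm ((step ^^ n) h - 0) < e" if "n \<ge> N" for n
  proof -
    have eq: "(step ^^ n) h = (step ^^ n) (adj (L g)) - (step ^^ n) (adj (L g) - h)"
      using bounded_linear.linear[OF bounded_linear_step_pow] by (simp add: linear_diff)
    have "norm ((step ^^ n) h) \<le> norm ((step ^^ n) (adj (L g))) + norm ((step ^^ n) (adj (L g) - h))"
      unfolding eq by (rule norm_triangle_ineq4)
    with N[OF that] g norm_step_pow_le[of n "adj (L g) - h"] show ?thesis by simp
  qed
  then show "\<exists>N. \<forall>n\<ge>N. norm ((step ^^ n) h - 0) < e" by blast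
qed

lemma partial_sum_tendsto_P: "(\<lambda>n. partial_sum ip1 ip2 L \<gamma> n f) \<longlonglongrightarrow> P f"
proof -
  have "(\<lambda>n. - (step ^^ n) (P f)) \<longlonglongrightarrow> - 0"
    by (intro tendsto_minus step_pow_tendsto_0 P_in_closure_and_L_P)
  then have "(\<lambda>n. partial_sum ip1 ip2 L \<gamma> n f - P f) \<longlonglongrightarrow> 0"
    by (simp flip: partial_sum_diff_P)
  then show ?thesis by (rule Lim_null[THEN iffD2])
qed

section \<open>Contraction rate on \<open>N_compl\<close> under stability\<close>

lemma step_in_N_compl: "g \<in> N_compl \<Longrightarrow> step g \<in> N_compl"
  by (auto simp: N_compl_iff H1.rip.diff_left H1.rip.scaleR_left H2.rip.zero_left
      rip_commute[of "adj _"] simp flip: rip_adj)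

lemma rip_step_commute: "rip (step x) y = rip x (step y)"
  using rip_adj[of x "L y"] rip_adj[of y "L x"]
  by (simp add: H1.rip.diff_left H1.rip.diff_right H1.rip.scaleR_left H1.rip.scaleR_right
      rip_commute[of "adj _"] rip_commute[of "L y"])

text \<open>On \<open>N_compl\<close> the numerical range of the self-adjoint operator \<open>step\<close> lies in
  \<open>[1 - \<gamma> * (onorm L)\<^sup>2, 1 - \<gamma> * \<mu>\<^sup>2]\<close>, and the norm of a self-adjoint operator is its numerical radius.\<close>

lemma norm_step_le_stable:
  assumes "stable_with ip1 L \<mu>" and x: "x \<in> N_compl"
  defines "q \<equiv> 1 - min (\<gamma> * \<mu>\<^sup>2) (2 - \<gamma> * (onorm L)\<^sup>2)"
  shows "norm (step x) \<le> q * norm x"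
proof -
  have numrange: "\<bar>rip (step g) g\<bar> \<le> q * (norm g)\<^sup>2" if g: "g \<in> N_compl" for g
  proof -
    have eq: "rip (step g) g = (norm g)\<^sup>2 - \<gamma> * (norm (L g))\<^sup>2"
      using rip_adj[of g "L g"]
      by (simp add: H1.rip.diff_left H1.rip.scaleR_left rip_commute[of "adj _"] rip_self)
    have "(\<mu> * norm g)\<^sup>2 \<le> (norm (L g))\<^sup>2"
      using assms(1) g by (intro power_mono) (auto simp: stable_with_def)
    then have "\<gamma> * (\<mu> * norm g)\<^sup>2 \<le> \<gamma> * (norm (L g))\<^sup>2"
      using gamma_pos by simp
    moreover have "\<gamma> * (norm (L g))\<^sup>2 \<le> \<gamma> * (onorm L * norm g)\<^sup>2"
      using gamma_pos norm_L_le by (intro mult_left_mono power_mono) auto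
    \<comment> \<open>\<open>q\<close> is the maximum of \<open>1 - \<gamma> * \<mu>\<^sup>2\<close>
      and \<open>\<gamma> * (onorm L)\<^sup>2 - 1\<close>, so it covers both signs of the absolute
      value.\<close>
    moreover have "(1 - \<gamma> * \<mu>\<^sup>2) * (norm g)\<^sup>2 \<le> q * (norm g)\<^sup>2"
      "(\<gamma> * (onorm L)\<^sup>2 - 1) * (norm g)\<^sup>2 \<le> q * (norm g)\<^sup>2"
      by (intro mult_right_mono; simp add: q_def)+
    ultimately show ?thesis
      unfolding eq by (simp add: abs_le_iff power_mult_distrib algebra_simps)
  qed
  show ?thesis
  proof (cases "step x = 0")
    case True
    have "0 \<le> q * (norm x)\<^sup>2" using numrange[OF x] by linarith
    then have "0 \<le> q * norm x"
      by (cases "x = 0") (auto simp: zero_le_mult_iff)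
    with True show ?thesis by simp
  next
    case False
    then have "x \<noteq> 0" by (auto simp: adj.zero L.zero)
    \<comment> \<open>Rescaling \<open>step x\<close> to the length of \<open>x\<close> makes
      \<open>rip (step x) y\<close> the product of the norms, and gives
      \<open>4 * (norm x)\<^sup>2\<close> in the parallelogram law.\<close>
    define s where "s = norm x / norm (step x)"
    define y where "y = s *\<^sub>R step x"
    have norm_y: "norm y = norm x" using False by (simp add: y_def s_def)
    have yN: "y \<in> N_compl"
      using step_in_N_compl[OF x] by (auto simp: y_def N_compl_iff H1.rip.scaleR_left)
    have xy: "x + y \<in> N_compl" "x - y \<in> N_compl"
      using x yN by (auto simp: N_compl_iff H1.rip.add_left H1.rip.diff_left)
    have lin: "linear step" using bounded_linear_step by (rule bounded_linear.linear)
    define a b where "a = step x" and "b = step y"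
    have steps: "step (x + y) = a + b" "step (x - y) = a - b"
      unfolding a_def b_def by (rule linear_add[OF lin] linear_diff[OF lin])+
    \<comment> \<open>Symmetry of \<open>step\<close> merges the two mixed terms, so the quadratic
      form at \<open>x + y\<close> and \<open>x - y\<close> controls
      \<open>rip (step x) y\<close>.\<close>
    have "rip b x = rip a y"
      unfolding a_def b_def by (metis rip_step_commute rip_commute)
    moreover have "rip (a + b) (x + y) - rip (a - b) (x - y) = 2 * rip a y + 2 * rip b x"
      by (simp add: H1.rip.add_left H1.rip.add_right H1.rip.diff_left H1.rip.diff_right)
    ultimately have "4 * rip (step x) y = rip (step (x + y)) (x + y) - rip (step (x - y)) (x - y)"
      unfolding steps a_def[symmetric] by simp
    also have "\<dots> \<le> q * ((norm (x + y))\<^sup>2 + (norm (x - y))\<^sup>2)"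
      using numrange[OF xy(1)] numrange[OF xy(2)] by (simp add: distrib_left)
    also have "\<dots> = 4 * (q * norm x * norm x)"
      unfolding H1.parallelogram norm_y by (simp add: power2_eq_square)
    finally have "rip (step x) y \<le> q * norm x * norm x" by simp
    moreover have "rip (step x) y = norm (step x) * norm x"
      using False by (simp add: y_def H1.rip.scaleR_right rip_self s_def power2_eq_square)
    ultimately show ?thesis using \<open>x \<noteq> 0\<close> by simp
  qed
qed

lemma partial_sum_rate:
  assumes "stable_with ip1 L \<mu>" and "0 \<le> q" and q: "q = 1 - min (\<gamma> * \<mu>\<^sup>2) (2 - \<gamma> * (onorm L)\<^sup>2)"
  shows "norm (partial_sum ip1 ip2 L \<gamma> n f - P f) \<le> q ^ n * norm (P f)"
proof -
  \<comment> \<open>Membership in \<open>N_compl\<close> is carried along because the contraction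
    estimate is available there.\<close>
  have "(step ^^ n) (P f) \<in> N_compl \<and> norm ((step ^^ n) (P f)) \<le> q ^ n * norm (P f)"
  proof (induction n)
    case (Suc n)
    have "norm ((step ^^ Suc n) (P f)) \<le> q * norm ((step ^^ n) (P f))"
      using norm_step_le_stable[OF assms(1), of "(step ^^ n) (P f)"] Suc unfolding q by simp
    also have "\<dots> \<le> q * (q ^ n * norm (P f))"
      using Suc assms(2) by (intro mult_left_mono) auto
    finally show ?case
      using Suc step_in_N_compl by (simp add: mult.assoc)
  qed (simp add: P_in)
  then show ?thesis by (simp add: partial_sum_diff_P)
qed

text \<open>For \<open>L f \<noteq> 0\<close> the vector \<open>P f\<close> is nonzero, and the
  contraction estimate at \<open>P f\<close> forces \<open>0 \<le> q\<close>. Both entries of the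
  minimum are positive, hence \<open>q < 1\<close>.\<close>

lemma rate_bounds:
  assumes "L \<noteq> (\<lambda>_. 0)" "stable_with ip1 L \<mu>"
  defines "q \<equiv> 1 - min (\<gamma> * \<mu>\<^sup>2) (2 - \<gamma> * (onorm L)\<^sup>2)"
  shows "0 \<le> q" "q < 1"
proof -
  obtain f where f: "L f \<noteq> 0" using assms(1) by auto
  have "P f \<noteq> 0"
    using f P_in_closure_and_L_P(2)[of f] by (auto simp: L.zero)
  moreover have "0 \<le> q * norm (P f)"
    using norm_step_le_stable[OF assms(2) P_in[of f]] norm_ge_zero order_trans
    unfolding q_def by blast
  ultimately show "0 \<le> q" by (simp add: zero_le_mult_iff)
  show "q < 1"
    using gap_pos gamma_pos assms(2) by (simp add: q_def stable_with_def)
qed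

section \<open>Uniform convergence is equivalent to stability\<close>

lemma stable_if_uniform:
  assumes "bounded_operator scale1 scale1 T"
    and lim: "(\<lambda>n. onorm (\<lambda>f. partial_sum ip1 ip2 L \<gamma> n f - T f)) \<longlonglongrightarrow> 0"
  shows "stable_problem ip1 L"
proof -
  have T: "bounded_linear T" using assms(1) by (simp add: bounded_operator_def)
  have bl: "bounded_linear (\<lambda>f. partial_sum ip1 ip2 L \<gamma> n f - T f)" for n
    unfolding partial_sum_eq
    by (intro bounded_linear_sub bounded_linear_ident bounded_linear_step_pow T)
  \<comment> \<open>Convergence in operator norm implies pointwise convergence, so the limit can
    only be \<open>P\<close>.\<close>
  have TP: "T f = P f" for f
  proof -
    have "(\<lambda>n. onorm (\<lambda>f. partial_sum ip1 ip2 L \<gamma> n f - T f) * norm f) \<longlonglongrightarrow> 0"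
      using tendsto_mult_left_zero[OF lim] .
    then have "(\<lambda>n. partial_sum ip1 ip2 L \<gamma> n f - T f) \<longlonglongrightarrow> 0"
      by (rule Lim_null_comparison[rotated]) (simp add: onorm[OF bl])
    then have "(\<lambda>n. partial_sum ip1 ip2 L \<gamma> n f) \<longlonglongrightarrow> T f"
      by (rule Lim_null[THEN iffD2])
    then show ?thesis
      using partial_sum_tendsto_P LIMSEQ_unique by blast
  qed
  obtain n where n: "onorm (\<lambda>f. partial_sum ip1 ip2 L \<gamma> n f - T f) < 1 / 2"
    using eventually_happens'[OF sequentially_bot order_tendstoD(2)[OF lim, of "1 / 2"]] by auto
  \<comment> \<open>\<open>n + 1\<close> instead of \<open>n\<close> keeps \<open>b\<close> positive
    also for \<open>n = 0\<close>.\<close>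
  define b where "b = \<gamma> * onorm L * real (n + 1)"
  have b: "b > 0" using gamma_pos onorm_L_pos by (simp add: b_def)
  have "1 / (2 * b) * norm g \<le> norm (L g)" if g: "g \<in> N_compl" for g
  proof -
    have term_le: "norm (series_term ip1 ip2 L \<gamma> j g) \<le> \<gamma> * onorm L * norm (L g)" for j
    proof -
      have "norm (series_term ip1 ip2 L \<gamma> j g) \<le> norm (\<gamma> *\<^sub>R adj (L g))"
        unfolding series_term_def by (rule norm_step_pow_le)
      also have "\<dots> \<le> \<gamma> * (onorm L * norm (L g))"
        using gamma_pos norm_adj_le by simp
      finally show ?thesis by simp
    qed
    have "norm (partial_sum ip1 ip2 L \<gamma> n g) \<le> (\<Sum>j<n. \<gamma> * onorm L * norm (L g))"
      unfolding partial_sum_def by (intro sum_norm_le term_le)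
    also have "\<dots> \<le> b * norm (L g)"
      using gamma_pos onorm_L_pos by (simp add: b_def algebra_simps)
    finally have "norm (partial_sum ip1 ip2 L \<gamma> n g) \<le> b * norm (L g)" .
    moreover have "norm (partial_sum ip1 ip2 L \<gamma> n g - g) \<le> 1 / 2 * norm g"
      using onorm[OF bl, of n g] mult_right_mono[OF less_imp_le[OF n] norm_ge_zero[of g]]
      by (simp add: TP P_eq_self[OF g])
    \<comment> \<open>The error \<open>norm g / 2\<close> is absorbed on the left.\<close>
    ultimately have "norm g \<le> 2 * b * norm (L g)"
      using norm_triangle_sub[of g "partial_sum ip1 ip2 L \<gamma> n g"]
      by (simp add: norm_minus_commute)
    then show ?thesis using b by (simp add: field_simps)
  qed
  then show ?thesis
    using b unfolding stable_problem_def stable_with_def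
    by (intro exI[of _ "1 / (2 * b)"]) auto
qed

lemma bounded_linear_partial_sum_diff_P:
  "bounded_linear (\<lambda>f. partial_sum ip1 ip2 L \<gamma> n f - P f)"
  unfolding partial_sum_eq using bounded_operator_P
  by (auto simp: bounded_operator_def
      intro!: bounded_linear_sub bounded_linear_ident bounded_linear_step_pow)

text \<open>The rate in terms of \<open>norm (P f)\<close> becomes an operator norm bound because
  \<open>P\<close> does not increase norms.\<close>

lemma uniform_if_stable:
  assumes "stable_with ip1 L \<mu>" and "0 \<le> q" "q < 1"
    and "q = 1 - min (\<gamma> * \<mu>\<^sup>2) (2 - \<gamma> * (onorm L)\<^sup>2)"
  shows "onorm (\<lambda>f. partial_sum ip1 ip2 L \<gamma> n f - P f) \<le> q ^ n"
    and "(\<lambda>n. onorm (\<lambda>f. partial_sum ip1 ip2 L \<gamma> n f - P f)) \<longlonglongrightarrow> 0"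
proof -
  show le: "onorm (\<lambda>f. partial_sum ip1 ip2 L \<gamma> n f - P f) \<le> q ^ n" for n
  proof (rule onorm_bound)
    fix f
    have "norm (partial_sum ip1 ip2 L \<gamma> n f - P f) \<le> q ^ n * norm (P f)"
      by (rule partial_sum_rate) fact+
    also have "\<dots> \<le> q ^ n * norm f"
      using assms(2) norm_P_le by (intro mult_left_mono) auto
    finally show "norm (partial_sum ip1 ip2 L \<gamma> n f - P f) \<le> q ^ n * norm f" .
  qed (use assms(2) in simp)
  show "(\<lambda>n. onorm (\<lambda>f. partial_sum ip1 ip2 L \<gamma> n f - P f)) \<longlonglongrightarrow> 0"
  proof (rule Lim_null_comparison)
    show "(\<lambda>n. q ^ n) \<longlonglongrightarrow> 0" using assms by (intro LIMSEQ_realpow_zero)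
    show "\<forall>\<^sub>F n in sequentially.
        norm (onorm (\<lambda>f. partial_sum ip1 ip2 L \<gamma> n f - P f)) \<le> q ^ n"
      using le onorm_pos_le[OF bounded_linear_partial_sum_diff_P] by simp
  qed
qed

end

theorem theorem3p1:
  fixes scale1 :: "'k::real_or_complex \<Rightarrow> 'a::banach \<Rightarrow> 'a"
    and scale2 :: "'k \<Rightarrow> 'b::banach \<Rightarrow> 'b"
    and ip1 :: "'a \<Rightarrow> 'a \<Rightarrow> 'k"
    and ip2 :: "'b \<Rightarrow> 'b \<Rightarrow> 'k"
    and L :: "'a \<Rightarrow> 'b"
    and \<gamma> :: real
  assumes "hilbert_space scale1 ip1"
    and "hilbert_space scale2 ip2"
    and "bounded_operator scale1 scale2 L"
    and "L \<noteq> (\<lambda>_. 0)"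
    and "0 < \<gamma>"
    and "\<gamma> < 2 / (onorm L)\<^sup>2"
  shows "(\<forall>f. (\<lambda>j. series_term ip1 ip2 L \<gamma> j f) sums proj_ker_compl ip1 L f) \<and>
    ((\<exists>T. bounded_operator scale1 scale1 T \<and>
          (\<lambda>N. onorm (\<lambda>f. partial_sum ip1 ip2 L \<gamma> N f - T f)) \<longlonglongrightarrow> 0)
      \<longleftrightarrow> stable_problem ip1 L) \<and>
    (stable_problem ip1 L \<longrightarrow>
      (\<lambda>N. onorm (\<lambda>f. partial_sum ip1 ip2 L \<gamma> N f - proj_ker_compl ip1 L f)) \<longlonglongrightarrow> 0 \<and>
      (\<exists>C q. 0 \<le> q \<and> q < 1 \<and>
        (\<forall>N. onorm (\<lambda>f. partial_sum ip1 ip2 L \<gamma> N f - proj_ker_compl ip1 L f) \<le> C * q ^ N)) \<and>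
      (let \<mu> = stability_constant ip1 L;
           \<nu> = min (\<gamma> * \<mu>\<^sup>2) (2 - \<gamma> * (onorm L)\<^sup>2)
       in \<forall>f. \<forall>N\<ge>1. norm (partial_sum ip1 ip2 L \<gamma> N f - proj_ker_compl ip1 L f)
            \<le> (1 - \<nu>) ^ N * norm (proj_ker_compl ip1 L f)))"
proof -
  interpret landweber scale1 ip1 scale2 ip2 L \<gamma>
    using assms by (simp add: landweber_def hilbert_operator_def hilbert_operator_axioms_def
        landweber_axioms_def)
  let ?\<mu> = "stability_constant ip1 L"
  let ?q = "1 - min (\<gamma> * ?\<mu>\<^sup>2) (2 - \<gamma> * (onorm L)\<^sup>2)"
  have sums: "\<forall>f. (\<lambda>j. series_term ip1 ip2 L \<gamma> j f) sums P f"
    using partial_sum_tendsto_P by (simp add: sums_def partial_sum_def)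
  have conv: "(\<lambda>N. onorm (\<lambda>f. partial_sum ip1 ip2 L \<gamma> N f - P f)) \<longlonglongrightarrow> 0"
    and exp: "\<exists>C q. 0 \<le> q \<and> q < 1 \<and>
        (\<forall>N. onorm (\<lambda>f. partial_sum ip1 ip2 L \<gamma> N f - P f) \<le> C * q ^ N)"
    and rate: "norm (partial_sum ip1 ip2 L \<gamma> N f - P f) \<le> ?q ^ N * norm (P f)"
    if "stable_problem ip1 L" for N f
  proof -
    note \<mu> = stability_constant[OF assms(4) that]
    note q = rate_bounds[OF assms(4) \<mu>]
    show "(\<lambda>N. onorm (\<lambda>f. partial_sum ip1 ip2 L \<gamma> N f - P f)) \<longlonglongrightarrow> 0"
      by (rule uniform_if_stable(2)[OF \<mu> q refl])
    show "\<exists>C q. 0 \<le> q \<and> q < 1 \<and>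
        (\<forall>N. onorm (\<lambda>f. partial_sum ip1 ip2 L \<gamma> N f - P f) \<le> C * q ^ N)"
      using q uniform_if_stable(1)[OF \<mu> q refl] by (intro exI[of _ 1] exI[of _ ?q]) simp
    show "norm (partial_sum ip1 ip2 L \<gamma> N f - P f) \<le> ?q ^ N * norm (P f)"
      by (rule partial_sum_rate[OF \<mu> q(1) refl])
  qed
  \<comment> \<open>Under stability, \<open>P\<close> serves as the limit operator
    \<open>T\<close>.\<close>
  show ?thesis
    unfolding Let_def
    using sums conv exp rate stable_if_uniform bounded_operator_P by blast
qed

end
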